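(* $\mathbf{CF}\subseteq\mathbf{P_{/poly}}$.
   Context: Binary strings of length $n$ are identified with vectors in $\{0,1\}^n$. $\mathbf{CF}$ is the set of languages $L\subseteq\{0,1\}^*$ for which there exists a polynomial $p$ such that for every $n\in\mathbb{N}$ there exist $A\in\mathbb{R}^{p(n)\times n}$, $B\in\mathbb{R}^{p(n)\times p(n)}$, $b\in\mathbb{R}^{p(n)}$ with $\operatorname{conv}(\{x\in L: |x|=n\})=\{x\in\mathbb{R}^n\mid\exists y\in\mathbb{R}^{p(n)}: Ax+By\le b\}$. $\mathbf{P_{/poly}}$ is the class of languages decidable by families of polynomial-size Boolean circuits (equivalently, by polynomial-time Turing machines with polynomial-length advice depending only on the input length). *)

theory Defs
  imports "HOL-Analysis.Analysis" "HOL-Computational_Algebra.Polynomial"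
begin

text \<open>A point of R^n is a function nat => real, the coordinates 0..n-1 being meaningful;
  coordinates outside are required to be 0 where relevant.\<close>

definition embed :: "bool list \<Rightarrow> (nat \<Rightarrow> real)" where
  "embed x = (\<lambda>i. if i < length x then (if x ! i then 1 else 0) else 0)"

definition conv :: "(nat \<Rightarrow> real) set \<Rightarrow> (nat \<Rightarrow> real) set" where
  "conv S = {x. \<exists>F w. finite F \<and> F \<subseteq> S \<and> (\<forall>s\<in>F. 0 \<le> w s) \<and> sum w F = 1 \<and>
                      x = (\<lambda>i. \<Sum>s\<in>F. w s * s i)}"

definition CF :: "bool list set set" where
  "CF = {L. \<exists>p :: nat poly. \<forall>n. \<exists>(A :: nat \<Rightarrow> nat \<Rightarrow> real) (B :: nat \<Rightarrow> nat \<Rightarrow> real) (b :: nat \<Rightarrow> real).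
      conv (embed ` {x \<in> L. length x = n}) =
      {x. (\<forall>i\<ge>n. x i = 0) \<and>
          (\<exists>y :: nat \<Rightarrow> real. \<forall>j < poly p n.
              (\<Sum>i<n. A j i * x i) + (\<Sum>k<poly p n. B j k * y k) \<le> b j)}}"

text \<open>A circuit is a list of gates; a gate may refer to input bits or to earlier gates
  (by their position in the list). The output is the value of the last gate.\<close>
datatype gate = Input nat | Cst bool | NotG nat | AndG nat nat | OrG nat nat

fun gate_val :: "bool list \<Rightarrow> bool list \<Rightarrow> gate \<Rightarrow> bool" where
  "gate_val x vs (Input i) = x ! i"
| "gate_val x vs (Cst c) = c"
| "gate_val x vs (NotG j) = (\<not> vs ! j)"
| "gate_val x vs (AndG j k) = (vs ! j \<and> vs ! k)"
| "gate_val x vs (OrG j k) = (vs ! j \<or> vs ! k)"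

definition gate_vals :: "gate list \<Rightarrow> bool list \<Rightarrow> bool list" where
  "gate_vals C x = foldl (\<lambda>vs g. vs @ [gate_val x vs g]) [] C"

definition circuit_out :: "gate list \<Rightarrow> bool list \<Rightarrow> bool" where
  "circuit_out C x = last (gate_vals C x)"

fun gate_wf :: "nat \<Rightarrow> nat \<Rightarrow> gate \<Rightarrow> bool" where
  "gate_wf n pos (Input i) = (i < n)"
| "gate_wf n pos (Cst c) = True"
| "gate_wf n pos (NotG j) = (j < pos)"
| "gate_wf n pos (AndG j k) = (j < pos \<and> k < pos)"
| "gate_wf n pos (OrG j k) = (j < pos \<and> k < pos)"

definition circuit_wf :: "nat \<Rightarrow> gate list \<Rightarrow> bool" where
  "circuit_wf n C = (C \<noteq> [] \<and> (\<forall>pos < length C. gate_wf n pos (C ! pos)))"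

definition P_poly :: "bool list set set" where
  "P_poly = {L. \<exists>p :: nat poly. \<forall>n. \<exists>C. circuit_wf n C \<and> length C \<le> poly p n \<and>
      (\<forall>x. length x = n \<longrightarrow> (circuit_out C x \<longleftrightarrow> x \<in> L))}"

end

theory Submission
  imports Defs
begin

text \<open>Fix a length \<open>n\<close> and let \<open>S\<close> be the words of \<open>L\<close> of that length. Instead of solving the linear
  program exactly, the circuit runs a perceptron. Send each \<open>z \<in> S\<close> to the point with coordinates
  \<open>z\<close>, \<open>1 - z\<close> and the slacks of the extended formulation at \<open>z\<close>, each slack divided by its maximum
  over \<open>S\<close>; these points lie in a unit cube. A word \<open>x\<close> is in \<open>S\<close> iff the affine hull of these points
  contains a point that dominates the 0/1 vector \<open>(x, 1 - x, 0)\<close>. Since a word outside \<open>S\<close> has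
  \<open>l1\<close>-distance at least 1 from \<open>conv S\<close>, dominance up to an error \<open>1 / poly(n)\<close> already suffices,
  whatever the size of the coefficients of the formulation. The perceptron moves inside the affine
  hull, so its steps are columns of an orthogonal projection, with entries in \<open>[-1, 1]\<close>. It stops
  after polynomially many steps on members, and each of its tests is a threshold function of earlier
  test results with integer weights of polynomial size. Projection and weights depend on \<open>n\<close> only
  and are hardwired.\<close>

subsection \<open>Straight-line programs\<close>

text \<open>Programs are tracked by the set of Boolean functions they have produced rather than by
  gate positions, so combining programs needs no index shifting. The counter records steps, not the
  size of the set, since a function may be produced twice.\<close>

inductive slp :: "nat \<Rightarrow> nat \<Rightarrow> (bool list \<Rightarrow> bool) set \<Rightarrow> bool" for n where
  slp_empty: "slp n 0 {}"
| slp_input: "slp n k F \<Longrightarrow> i < n \<Longrightarrow> slp n (Suc k) (insert (\<lambda>x. x ! i) F)"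
| slp_const: "slp n k F \<Longrightarrow> slp n (Suc k) (insert (\<lambda>x. c) F)"
| slp_not: "slp n k F \<Longrightarrow> f \<in> F \<Longrightarrow> slp n (Suc k) (insert (\<lambda>x. \<not> f x) F)"
| slp_and: "slp n k F \<Longrightarrow> f \<in> F \<Longrightarrow> g \<in> F \<Longrightarrow> slp n (Suc k) (insert (\<lambda>x. f x \<and> g x) F)"
| slp_or: "slp n k F \<Longrightarrow> f \<in> F \<Longrightarrow> g \<in> F \<Longrightarrow> slp n (Suc k) (insert (\<lambda>x. f x \<or> g x) F)"

section \<open>Translation of straight-line programs into gate lists\<close>

lemma gate_vals_snoc:
  "gate_vals (C @ [g]) x = gate_vals C x @ [gate_val x (gate_vals C x) g]"
  by (simp add: gate_vals_def)

lemma length_gate_vals [simp]: "length (gate_vals C x) = length C"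
proof (induction C rule: rev_induct)
  case Nil
  show ?case by (simp add: gate_vals_def)
qed (simp add: gate_vals_snoc)

text \<open>The equation is asked for lists \<open>x\<close> of every length. This is harmless: an
  input gate and the function \<open>x ! i\<close> are the same term even when \<open>i\<close> is
  out of range.\<close>

definition implements :: "nat \<Rightarrow> gate list \<Rightarrow> (bool list \<Rightarrow> bool) set \<Rightarrow> bool" where
  "implements n C F \<longleftrightarrow> (\<forall>pos < length C. gate_wf n pos (C ! pos)) \<and>
     (\<forall>f\<in>F. \<exists>j < length C. \<forall>x. gate_vals C x ! j = f x)"

lemma implementsE:
  assumes "implements n C F" "f \<in> F"
  obtains j where "j < length C" "\<And>x. gate_vals C x ! j = f x"
  using assms unfolding implements_def by blast

text \<open>Appending a gate changes neither the positions nor the values of the earlier gates, so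
  only the new last position has to be checked.\<close>

lemma implements_snoc:
  assumes "implements n C F" "gate_wf n (length C) g"
    and "\<And>x. gate_val x (gate_vals C x) g = f x"
  shows "implements n (C @ [g]) (insert f F)"
  unfolding implements_def
proof (intro conjI ballI allI impI)
  fix pos assume "pos < length (C @ [g])"
  then show "gate_wf n pos ((C @ [g]) ! pos)"
    using assms by (auto simp: implements_def nth_append less_Suc_eq)
next
  fix f' assume f': "f' \<in> insert f F"
  show "\<exists>j<length (C @ [g]). \<forall>x. gate_vals (C @ [g]) x ! j = f' x"
  proof (cases "f' = f")
    case True
    then show ?thesis
      using assms(3) by (intro exI[of _ "length C"]) (simp add: gate_vals_snoc nth_append)
  next
    case False
    with f' assms(1) obtain j where "j < length C" "\<forall>x. gate_vals C x ! j = f' x"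
      unfolding implements_def by blast
    then show ?thesis
      by (intro exI[of _ j]) (simp add: gate_vals_snoc nth_append)
  qed
qed

lemma slp_implements:
  assumes "slp n k F"
  shows "\<exists>C. length C = k \<and> implements n C F"
  using assms
proof induction
  case slp_empty
  then show ?case by (simp add: implements_def)
next
  case (slp_input k F i)
  then obtain C where C: "length C = k" "implements n C F" by blast
  have "implements n (C @ [Input i]) (insert (\<lambda>x. x ! i) F)"
    by (rule implements_snoc) (use C slp_input in auto)
  with C show ?case by (intro exI[of _ "C @ [Input i]"]) simp
next
  case (slp_const k F c)
  then obtain C where C: "length C = k" "implements n C F" by blast
  have "implements n (C @ [Cst c]) (insert (\<lambda>x. c) F)"
    by (rule implements_snoc) (use C in auto)
  with C show ?case by (intro exI[of _ "C @ [Cst c]"]) simp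
next
  case (slp_not k F f)
  then obtain C where C: "length C = k" "implements n C F" by blast
  obtain j where "j < length C" "\<And>x. gate_vals C x ! j = f x"
    using implementsE[OF C(2) slp_not.hyps(2)] by blast
  then have "implements n (C @ [NotG j]) (insert (\<lambda>x. \<not> f x) F)"
    using C by (intro implements_snoc) auto
  with C show ?case by (intro exI[of _ "C @ [NotG j]"]) simp
next
  case (slp_and k F f g)
  then obtain C where C: "length C = k" "implements n C F" by blast
  obtain j where "j < length C" "\<And>x. gate_vals C x ! j = f x"
    using implementsE[OF C(2) slp_and.hyps(2)] by blast
  moreover obtain l where "l < length C" "\<And>x. gate_vals C x ! l = g x"
    using implementsE[OF C(2) slp_and.hyps(3)] by blast
  ultimately have "implements n (C @ [AndG j l]) (insert (\<lambda>x. f x \<and> g x) F)"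
    using C by (intro implements_snoc) auto
  with C show ?case by (intro exI[of _ "C @ [AndG j l]"]) simp
next
  case (slp_or k F f g)
  then obtain C where C: "length C = k" "implements n C F" by blast
  obtain j where "j < length C" "\<And>x. gate_vals C x ! j = f x"
    using implementsE[OF C(2) slp_or.hyps(2)] by blast
  moreover obtain l where "l < length C" "\<And>x. gate_vals C x ! l = g x"
    using implementsE[OF C(2) slp_or.hyps(3)] by blast
  ultimately have "implements n (C @ [OrG j l]) (insert (\<lambda>x. f x \<or> g x) F)"
    using C by (intro implements_snoc) auto
  with C show ?case by (intro exI[of _ "C @ [OrG j l]"]) simp
qed

text \<open>Allowing a smaller program and additional functions makes the notion monotone: costs
  become upper bounds and intermediate results can be forgotten.\<close>

definition computes :: "nat \<Rightarrow> nat \<Rightarrow> (bool list \<Rightarrow> bool) set \<Rightarrow> bool" where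
  "computes n k F \<longleftrightarrow> (\<exists>k'\<le>k. \<exists>F'. F \<subseteq> F' \<and> slp n k' F')"

lemma computes_empty: "computes n 0 {}"
  unfolding computes_def using slp_empty by blast

lemma computes_mono: "computes n k F \<Longrightarrow> k \<le> k' \<Longrightarrow> F' \<subseteq> F \<Longrightarrow> computes n k' F'"
  unfolding computes_def by (meson order_trans)

text \<open>The extension step is required for every superset of \<open>F\<close>, because the
  underlying program may hold functions that \<open>F\<close> does not list.\<close>

lemma computes_insertI:
  assumes "computes n k F"
    and "\<And>k F'. F \<subseteq> F' \<Longrightarrow> slp n k F' \<Longrightarrow> slp n (Suc k) (insert f F')"
  shows "computes n (Suc k) (insert f F)"
proof -
  obtain k' F' where "k' \<le> k" "F \<subseteq> F'" "slp n k' F'"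
    using assms(1) unfolding computes_def by blast
  with assms(2)[of F' k'] show ?thesis
    unfolding computes_def by (intro exI[of _ "Suc k'"] conjI exI[of _ "insert f F'"]) auto
qed

lemma computes_input: "computes n k F \<Longrightarrow> i < n \<Longrightarrow> computes n (Suc k) (insert (\<lambda>x. x ! i) F)"
  and computes_const: "computes n k F \<Longrightarrow> computes n (Suc k) (insert (\<lambda>x. c) F)"
  and computes_not: "computes n k F \<Longrightarrow> f \<in> F \<Longrightarrow> computes n (Suc k) (insert (\<lambda>x. \<not> f x) F)"
  and computes_and: "computes n k F \<Longrightarrow> f \<in> F \<Longrightarrow> g \<in> F \<Longrightarrow>
    computes n (Suc k) (insert (\<lambda>x. f x \<and> g x) F)"
  and computes_or: "computes n k F \<Longrightarrow> f \<in> F \<Longrightarrow> g \<in> F \<Longrightarrow>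
    computes n (Suc k) (insert (\<lambda>x. f x \<or> g x) F)"
  by (erule computes_insertI; auto intro: slp.intros)+

lemma computes_if:
  assumes "computes n k F" "f \<in> F" "g \<in> F" "h \<in> F"
  shows "computes n (k + 4) (insert (\<lambda>x. if f x then g x else h x) F)"
proof -
  define F1 where "F1 = insert (\<lambda>x. \<not> f x) F"
  define F2 where "F2 = insert (\<lambda>x. f x \<and> g x) F1"
  define F3 where "F3 = insert (\<lambda>x. \<not> f x \<and> h x) F2"
  have "computes n (Suc k) F1"
    unfolding F1_def using assms computes_not by blast
  then have "computes n (Suc (Suc k)) F2"
    unfolding F2_def by (rule computes_and) (use assms F1_def in auto)
  then have "computes n (Suc (Suc (Suc k))) F3"
    unfolding F3_def by (rule computes_and) (use assms F1_def F2_def in auto)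
  then have "computes n (Suc (Suc (Suc (Suc k))))
      (insert (\<lambda>x. (f x \<and> g x) \<or> (\<not> f x \<and> h x)) F3)"
    by (rule computes_or) (use F2_def F3_def in auto)
  moreover have "(\<lambda>x. (f x \<and> g x) \<or> (\<not> f x \<and> h x)) = (\<lambda>x. if f x then g x else h x)"
    by auto
  ultimately have "computes n (k + 4) (insert (\<lambda>x. if f x then g x else h x) F3)"
    by (simp add: numeral_eq_Suc)
  then show ?thesis
    by (rule computes_mono) (auto simp: F1_def F2_def F3_def)
qed

text \<open>Induction on \<open>G\<close>, paying \<open>c\<close> per function. The step must work
  over any superset of \<open>F\<close>, since the members of \<open>G\<close> added before are
  present as well.\<close>

lemma computes_Un:
  assumes "finite G" "computes n k F"
    and step: "\<And>g k F'. g \<in> G \<Longrightarrow> F \<subseteq> F' \<Longrightarrow> computes n k F' \<Longrightarrow> computes n (k + c) (insert g F')"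
  shows "computes n (k + card G * c) (F \<union> G)"
  using assms(1) step
proof (induction G)
  case empty
  then show ?case using assms(2) by simp
next
  case (insert g G)
  then have "computes n (k + card G * c) (F \<union> G)" by blast
  then have "computes n (k + card G * c + c) (insert g (F \<union> G))"
    using insert.prems by blast
  then show ?case using insert.hyps by (simp add: algebra_simps)
qed

lemma computes_image:
  assumes "finite A" "computes n k F"
    and step: "\<And>a k F'. a \<in> A \<Longrightarrow> F \<subseteq> F' \<Longrightarrow> computes n k F' \<Longrightarrow> computes n (k + c) (insert (f a) F')"
  shows "computes n (k + card A * c) (F \<union> f ` A)"
proof -
  have "computes n (k + card (f ` A) * c) (F \<union> f ` A)"
    by (rule computes_Un) (use assms in auto)
  then show ?thesis
    by (rule computes_mono) (use assms(1) card_image_le in auto)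
qed

lemma computes_Bex:
  assumes "finite A" "computes n k F" "\<And>a. a \<in> A \<Longrightarrow> f a \<in> F"
  shows "computes n (k + card A + 1) (insert (\<lambda>x. \<exists>a\<in>A. f a x) F)"
  using assms(1,3)
proof (induction A)
  case empty
  then show ?case using computes_const[OF assms(2), of False] by simp
next
  case (insert a A)
  have "computes n (Suc (k + card A + 1))
      (insert (\<lambda>x. f a x \<or> (\<exists>a\<in>A. f a x)) (insert (\<lambda>x. \<exists>a\<in>A. f a x) F))"
    by (rule computes_or) (use insert in auto)
  then show ?case
    by (rule computes_mono) (use insert.hyps in auto)
qed

lemma computes_imp_circuit:
  assumes "computes n k F" "f \<in> F"
  shows "\<exists>C. circuit_wf n C \<and> length C \<le> Suc k \<and> (\<forall>x. circuit_out C x = f x)"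
proof -
  obtain k' F' where k': "k' \<le> k" "F \<subseteq> F'" "slp n k' F'"
    using assms(1) unfolding computes_def by blast
  then obtain C where C: "length C = k'" "implements n C F'"
    using slp_implements by blast
  have "f \<in> F'" using assms k' by blast
  then obtain j where j: "j < length C" "\<forall>x. gate_vals C x ! j = f x"
    using C unfolding implements_def by blast
  \<comment> \<open>The output is read off the last gate, so the wanted value is copied there. This
    accounts for the \<open>Suc\<close> in the size bound and makes the circuit nonempty.\<close>
  have "implements n (C @ [AndG j j]) (insert f F')"
    by (rule implements_snoc) (use C j in auto)
  then have "circuit_wf n (C @ [AndG j j])"
    by (auto simp: implements_def circuit_wf_def)
  moreover have "circuit_out (C @ [AndG j j]) x = f x" for x
    using j by (simp add: circuit_out_def gate_vals_snoc)
  ultimately show ?thesis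
    using C k' by (intro exI[of _ "C @ [AndG j j]"]) auto
qed

subsection \<open>Threshold functions\<close>

definition threshold :: "'a set \<Rightarrow> ('a \<Rightarrow> int) \<Rightarrow> ('a \<Rightarrow> bool list \<Rightarrow> bool) \<Rightarrow> int \<Rightarrow> bool list \<Rightarrow> bool"
  where "threshold A w f \<theta> x \<longleftrightarrow> \<theta> \<le> (\<Sum>a\<in>A. w a * of_bool (f a x))"

text \<open>A dynamic program over \<open>A\<close>: all thresholds of the partial sum are kept, and
  a new summand turns each of them into a choice between two old ones. Only
  \<open>2 * N * R + 1\<close> values of the threshold give functions that may be nonconstant, so
  the infinite range costs finitely many gates.\<close>

lemma computes_threshold:
  fixes w :: "'a \<Rightarrow> int"
  assumes "finite A" "card A \<le> N" "computes n k F"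
    and "\<And>a. a \<in> A \<Longrightarrow> f a \<in> F" "\<And>a. a \<in> A \<Longrightarrow> \<bar>w a\<bar> \<le> int R"
    and const_mem: "(\<lambda>x. True) \<in> F" "(\<lambda>x. False) \<in> F"
  shows "computes n (k + card A * ((2 * N * R + 1) * 4)) (F \<union> range (threshold A w f))"
  using assms(1,2,4,5)
proof (induction A)
  case empty
  have eq: "threshold {} w f \<theta> = (\<lambda>x. \<theta> \<le> 0)" for \<theta>
    by (simp add: fun_eq_iff threshold_def)
  have "threshold {} w f \<theta> \<in> F" for \<theta>
    using const_mem by (cases "\<theta> \<le> 0") (simp_all add: eq)
  then have "range (threshold {} w f) \<subseteq> F" by blast
  then show ?case
    using assms(3) by (simp add: sup_absorb1)
next
  case (insert a A)
  define F1 where "F1 = F \<union> range (threshold A w f)"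
  \<comment> \<open>As \<open>N\<close> bounds the size of every index set in the induction, the
    same interval serves at each stage.\<close>
  define I where "I = {- int (N * R)..int (N * R)}"
  have IH: "computes n (k + card A * ((2 * N * R + 1) * 4)) F1"
    unfolding F1_def using insert by simp
  \<comment> \<open>If \<open>f a x\<close> holds, the new summand contributes \<open>w a\<close>,
    which lowers what the remaining sum has to reach.\<close>
  have split: "threshold (insert a A) w f \<theta> =
      (\<lambda>x. if f a x then threshold A w f (\<theta> - w a) x else threshold A w f \<theta> x)" for \<theta>
    using insert.hyps by (auto simp: fun_eq_iff threshold_def)
  have "computes n (k + card A * ((2 * N * R + 1) * 4) + card I * 4)
      (F1 \<union> threshold (insert a A) w f ` I)"
  proof (rule computes_image)
    fix \<theta> l F' assume "F1 \<subseteq> F'" "computes n l F'"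
    then show "computes n (l + 4) (insert (threshold (insert a A) w f \<theta>) F')"
      unfolding split by (intro computes_if) (use insert.prems F1_def in auto)
  qed (use IH I_def in auto)
  moreover have card_I: "card I = 2 * N * R + 1"
    unfolding I_def by (simp add: nat_add_distrib nat_mult_distrib flip: of_nat_mult)
  moreover have "F \<union> range (threshold (insert a A) w f) \<subseteq> F1 \<union> threshold (insert a A) w f ` I"
  proof -
    have "threshold (insert a A) w f \<theta> \<in> F1" if "\<theta> \<notin> I" for \<theta>
    proof -
      have bound: "\<bar>\<Sum>b\<in>insert a A. w b * of_bool (f b x)\<bar> \<le> int (N * R)" for x
      proof -
        have "\<bar>\<Sum>b\<in>insert a A. w b * of_bool (f b x)\<bar> \<le> (\<Sum>b\<in>insert a A. \<bar>w b * of_bool (f b x)\<bar>)"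
          by (rule sum_abs)
        also have "\<dots> \<le> (\<Sum>b\<in>insert a A. int R)"
          by (rule sum_mono) (use insert.prems in auto)
        also have "\<dots> = int (card (insert a A)) * int R" by simp
        also have "\<dots> \<le> int (N * R)"
          using insert.prems(1) by (simp add: mult_right_mono flip: of_nat_mult)
        finally show ?thesis .
      qed
      from that consider "\<theta> > int (N * R)" | "\<theta> < - int (N * R)"
        unfolding I_def by fastforce
      then show ?thesis
      proof cases
        case 1
        have "\<not> \<theta> \<le> (\<Sum>b\<in>insert a A. w b * of_bool (f b x))" for x
          using 1 bound[of x] by linarith
        then have "threshold (insert a A) w f \<theta> = (\<lambda>x. False)"
          unfolding threshold_def by blast
        then show ?thesis using const_mem by (simp add: F1_def)
      next
        case 2
        have "\<theta> \<le> (\<Sum>b\<in>insert a A. w b * of_bool (f b x))" for x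
          using 2 bound[of x] by linarith
        then have "threshold (insert a A) w f \<theta> = (\<lambda>x. True)"
          unfolding threshold_def by blast
        then show ?thesis using const_mem by (simp add: F1_def)
      qed
    qed
    then show ?thesis by (auto simp: F1_def)
  qed
  ultimately have "computes n (k + card A * ((2 * N * R + 1) * 4) + (2 * N * R + 1) * 4)
      (F \<union> range (threshold (insert a A) w f))"
    by (metis computes_mono order_refl)
  then show ?case
    using insert.hyps by (simp add: algebra_simps)
qed

subsection \<open>Orthogonal projections\<close>

text \<open>Spans are never constructed: lying in the span of \<open>S\<close> is expressed as
  membership in every linear set containing \<open>S\<close>, and is used by choosing a suitable
  linear set.\<close>

definition linear_set :: "('i \<Rightarrow> real) set \<Rightarrow> bool" where
  "linear_set V \<longleftrightarrow> (\<lambda>i. 0) \<in> V \<and> (\<forall>u\<in>V. \<forall>v\<in>V. \<forall>a. (\<lambda>i. u i + a * v i) \<in> V)"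

lemma linear_set_zero: "linear_set V \<Longrightarrow> (\<lambda>i. 0) \<in> V"
  by (simp add: linear_set_def)

lemma linear_set_add_scale:
  "linear_set V \<Longrightarrow> u \<in> V \<Longrightarrow> v \<in> V \<Longrightarrow> (\<lambda>i. u i + a * v i) \<in> V"
  by (simp add: linear_set_def)

lemma linear_set_sum:
  assumes "linear_set V" "finite J" "\<And>j. j \<in> J \<Longrightarrow> v j \<in> V"
  shows "(\<lambda>i. \<Sum>j\<in>J. a j * v j i) \<in> V"
  using assms(2,3)
proof (induction J)
  case empty
  show ?case using linear_set_zero[OF assms(1)] by simp
next
  case (insert j J)
  have "(\<lambda>i. (\<Sum>j\<in>J. a j * v j i) + a j * v j i) \<in> V"
    by (rule linear_set_add_scale) (use insert assms(1) in auto)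
  then show ?case using insert.hyps by (simp add: add.commute)
qed

lemma linear_set_orthogonal: "linear_set {v. (\<Sum>i\<in>I. u i * v i) = 0}"
  for u :: "'i \<Rightarrow> real"
proof -
  have "(\<Sum>i\<in>I. u i * (v i + a * w i)) = (\<Sum>i\<in>I. u i * v i) + a * (\<Sum>i\<in>I. u i * w i)" for v w a
    by (simp add: algebra_simps sum.distrib sum_distrib_left)
  then show ?thesis by (simp add: linear_set_def)
qed

text \<open>Being fixed by a row of the projection is a linear condition on \<open>v\<close>, so it
  passes from generators to their span.\<close>

lemma linear_set_reproducing: "linear_set {v. (\<Sum>i\<in>I. u i * v i) = v j}"
  for u :: "'i \<Rightarrow> real"
proof -
  have "(\<Sum>i\<in>I. u i * (v i + a * w i)) = (\<Sum>i\<in>I. u i * v i) + a * (\<Sum>i\<in>I. u i * w i)" for v w a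
    by (simp add: algebra_simps sum.distrib sum_distrib_left)
  then show ?thesis by (simp add: linear_set_def)
qed

text \<open>The second condition says that the columns of \<open>P\<close> lie in the span of \<open>S\<close>.\<close>

definition projects :: "'i set \<Rightarrow> ('i \<Rightarrow> real) set \<Rightarrow> ('i \<Rightarrow> 'i \<Rightarrow> real) \<Rightarrow> bool" where
  "projects I S P \<longleftrightarrow> (\<forall>i j. P i j = P j i) \<and>
     (\<forall>V. linear_set V \<longrightarrow> S \<subseteq> V \<longrightarrow> (\<forall>j\<in>I. P j \<in> V)) \<and>
     (\<forall>s\<in>S. \<forall>j\<in>I. (\<Sum>i\<in>I. P j i * s i) = s j)"

lemma projects_sym: "projects I S P \<Longrightarrow> P i j = P j i"
  and projects_span: "projects I S P \<Longrightarrow> linear_set V \<Longrightarrow> S \<subseteq> V \<Longrightarrow> j \<in> I \<Longrightarrow> P j \<in> V"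
  and projects_id: "projects I S P \<Longrightarrow> s \<in> S \<Longrightarrow> j \<in> I \<Longrightarrow> (\<Sum>i\<in>I. P j i * s i) = s j"
  unfolding projects_def by blast+

text \<open>One Gram-Schmidt step: the part \<open>r\<close> of \<open>s\<close> orthogonal to
  \<open>S\<close> is split off, and the projection onto the line of \<open>r\<close> is added to
  \<open>P\<close>.\<close>

lemma projects_insert:
  fixes I :: "'i set"
  assumes "finite I" and P: "projects I S P"
  shows "\<exists>P'. projects I (insert s S) P'"
proof -
  define r where "r = (\<lambda>i. s i - (\<Sum>j\<in>I. s j * P j i))"
  define R where "R = (\<Sum>i\<in>I. r i * r i)"
  have Ps: "(\<Sum>i\<in>I. P j i * s i) = s j - r j" for j
    using projects_sym[OF P] by (simp add: r_def mult.commute)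
  have r_span: "r \<in> V" if V: "linear_set V" "insert s S \<subseteq> V" for V
  proof -
    have "(\<lambda>i. \<Sum>j\<in>I. s j * P j i) \<in> V"
      by (rule linear_set_sum) (use assms V projects_span[OF P] in auto)
    then have "(\<lambda>i. s i + (-1) * (\<Sum>j\<in>I. s j * P j i)) \<in> V"
      using V linear_set_add_scale by blast
    then show ?thesis by (simp add: r_def)
  qed
  have r_S: "(\<Sum>i\<in>I. r i * s' i) = 0" if "s' \<in> S" for s'
  proof -
    have "(\<Sum>i\<in>I. r i * s' i) = (\<Sum>i\<in>I. s i * s' i) - (\<Sum>i\<in>I. \<Sum>j\<in>I. s j * (P j i * s' i))"
      by (simp add: r_def algebra_simps sum_subtractf sum_distrib_left sum_distrib_right)
    also have "(\<Sum>i\<in>I. \<Sum>j\<in>I. s j * (P j i * s' i)) = (\<Sum>j\<in>I. s j * (\<Sum>i\<in>I. P j i * s' i))"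
      by (subst sum.swap) (simp add: sum_distrib_left)
    also have "\<dots> = (\<Sum>j\<in>I. s j * s' j)"
      by (rule sum.cong) (use projects_id[OF P that] in auto)
    finally show ?thesis by simp
  qed
  \<comment> \<open>The vectors orthogonal to \<open>r\<close> form a linear set containing
    \<open>S\<close>, hence also the columns of \<open>P\<close>.\<close>
  have r_P: "(\<Sum>i\<in>I. r i * P j i) = 0" if "j \<in> I" for j
    using projects_span[OF P linear_set_orthogonal[where I = I and u = r] _ that] r_S by blast
  have r_s: "(\<Sum>i\<in>I. r i * s i) = R"
  proof -
    have "(\<Sum>i\<in>I. r i * s i) - R = (\<Sum>i\<in>I. r i * (\<Sum>j\<in>I. s j * P j i))"
      by (simp add: R_def r_def algebra_simps flip: sum_subtractf)
    also have "\<dots> = (\<Sum>i\<in>I. \<Sum>j\<in>I. s j * (r i * P j i))"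
      by (simp add: sum_distrib_left algebra_simps)
    also have "\<dots> = (\<Sum>j\<in>I. s j * (\<Sum>i\<in>I. r i * P j i))"
      by (subst sum.swap) (simp add: sum_distrib_left)
    also have "\<dots> = 0" using r_P by simp
    finally show ?thesis by simp
  qed
  show ?thesis
  proof (cases "R = 0")
    case True
    \<comment> \<open>The residual vanishes on \<open>I\<close>, so \<open>P\<close> already
      reproduces \<open>s\<close> there and need not change.\<close>
    then have "r i = 0" if "i \<in> I" for i
      using sum_nonneg_eq_0_iff[OF assms(1), of "\<lambda>i. r i * r i"] that by (simp add: R_def)
    then have "projects I (insert s S) P"
      using P Ps unfolding projects_def by auto
    then show ?thesis by blast
  next
    case False
    \<comment> \<open>Rank-one update by \<open>r r^T / |r|^2\<close>, where \<open>R\<close> is the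
      squared norm of \<open>r\<close> on \<open>I\<close>.\<close>
    define P' where "P' = (\<lambda>j i. P j i + r j / R * r i)"
    have "projects I (insert s S) P'"
      unfolding projects_def
    proof (intro conjI allI ballI impI)
      fix i j show "P' i j = P' j i"
        using projects_sym[OF P, of i j] by (simp add: P'_def)
    next
      fix V j assume "linear_set V" "insert s S \<subseteq> V" "j \<in> I"
      then show "P' j \<in> V"
        unfolding P'_def using r_span projects_span[OF P, of V j] linear_set_add_scale by blast
    next
      fix s' j assume s': "s' \<in> insert s S" and j: "j \<in> I"
      have "(\<Sum>i\<in>I. P' j i * s' i) = (\<Sum>i\<in>I. P j i * s' i) + r j / R * (\<Sum>i\<in>I. r i * s' i)"
        by (simp add: P'_def algebra_simps sum.distrib sum_distrib_left)
      moreover have "(\<Sum>i\<in>I. P j i * s i) + r j / R * (\<Sum>i\<in>I. r i * s i) = s j"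
        using False by (simp add: Ps r_s)
      moreover have "(\<Sum>i\<in>I. P j i * s' i) + r j / R * (\<Sum>i\<in>I. r i * s' i) = s' j" if "s' \<in> S"
        using that projects_id[OF P that j] r_S by simp
      ultimately show "(\<Sum>i\<in>I. P' j i * s' i) = s' j"
        using s' by auto
    qed
    then show ?thesis by blast
  qed
qed

lemma projects_exists:
  assumes "finite I" "finite S"
  shows "\<exists>P. projects I S P"
  using assms(2)
proof (induction S)
  case empty
  have "projects I {} (\<lambda>_ _. 0)"
    by (simp add: projects_def linear_set_zero)
  then show ?case by blast
next
  case (insert s S)
  then show ?case using projects_insert[OF assms(1)] by blast
qed

lemma projects_reproduce:
  assumes "projects I S P" "\<And>V. linear_set V \<Longrightarrow> S \<subseteq> V \<Longrightarrow> v \<in> V" "j \<in> I"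
  shows "(\<Sum>i\<in>I. P j i * v i) = v j"
  using assms(2)[OF linear_set_reproducing[where I = I and u = "P j" and j = j]] projects_id[OF assms(1) _ assms(3)] by blast

lemma projects_idem:
  assumes "projects I S P" "j \<in> I" "k \<in> I"
  shows "(\<Sum>i\<in>I. P j i * P k i) = P k j"
  by (rule projects_reproduce[OF assms(1) _ assms(2)], rule projects_span[OF assms(1) _ _ assms(3)])

text \<open>By idempotence and symmetry, \<open>P i i\<close> is the squared norm of row
  \<open>i\<close>, so it dominates each squared entry of that row. Its own square being among them
  forces \<open>P i i\<close> to be at most 1.\<close>

lemma projects_abs_le_1:
  assumes "finite I" "projects I S P" "i \<in> I" "j \<in> I"
  shows "\<bar>P i j\<bar> \<le> 1"
proof -
  have sq: "P i k * P i k \<le> P i i" if "k \<in> I" for k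
  proof -
    have "P i k * P i k \<le> (\<Sum>k\<in>I. P i k * P i k)"
      by (rule member_le_sum[of k I "\<lambda>k. P i k * P i k"]) (use assms that in auto)
    then show ?thesis using projects_idem[OF assms(2,3,3)] by simp
  qed
  have "P i i \<le> 1"
  proof (rule ccontr)
    assume "\<not> P i i \<le> 1"
    then show False
      using sq[OF assms(3)] mult_strict_left_mono[of 1 "P i i" "P i i"] by simp
  qed
  with sq[OF assms(4)] have "P i j * P i j \<le> 1" by linarith
  then have "(P i j)\<^sup>2 \<le> 1" by (simp only: power2_eq_square)
  then show ?thesis by (rule abs_square_le_1[THEN iffD1])
qed

subsection \<open>A perceptron with rounded tests\<close>

text \<open>The real iterate \<open>point x t\<close> starts at \<open>v0\<close> and moves by \<open>1/h\<close> along the projected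
  unit vector \<open>P i\<close> whenever the constraint \<open>point x t i \<ge> of_bool (lit i x)\<close> is found violated.
  It is determined by the integer counts of past violations, and the test uses these counts with
  integer weights obtained by scaling with \<open>Q\<close> and rounding down; \<open>E\<close> bounds the rounding error.\<close>

definition step_denominator :: "nat \<Rightarrow> nat \<Rightarrow> nat" where
  "step_denominator m K = K * (m + 1)"

text \<open>The squared distance to a feasible point is at most \<open>m\<close> initially and drops
  by at least \<open>1 / (h * K)\<close> per round with a violation; the extra 1 makes the bound
  contradictory.\<close>

definition max_steps :: "nat \<Rightarrow> nat \<Rightarrow> nat" where
  "max_steps m K = m * K * step_denominator m K + 1"

text \<open>One unit for rounding \<open>v0\<close>, and for each of the \<open>m\<close> weights at
  most one unit per round counted.\<close>

definition rounding_error :: "nat \<Rightarrow> nat \<Rightarrow> nat" where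
  "rounding_error m K = 1 + m * max_steps m K"

text \<open>Chosen so that the rounding error, rescaled to the real iterate, is exactly
  \<open>1 / K\<close>.\<close>

definition weight_scale :: "nat \<Rightarrow> nat \<Rightarrow> nat" where
  "weight_scale m K = rounding_error m K * K"

locale perceptron =
  fixes m K :: nat
    and D :: "(nat \<Rightarrow> real) set"
    and P :: "nat \<Rightarrow> nat \<Rightarrow> real"
    and v0 :: "nat \<Rightarrow> real"
    and lit :: "nat \<Rightarrow> bool list \<Rightarrow> bool"
  assumes K_pos: "K > 0"
    and P: "projects {..<m} D P"
    and v0: "\<And>i. i < m \<Longrightarrow> 0 \<le> v0 i \<and> v0 i \<le> 1"
begin

abbreviation h :: nat where "h \<equiv> step_denominator m K"
abbreviation T :: nat where "T \<equiv> max_steps m K"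
abbreviation E :: nat where "E \<equiv> rounding_error m K"
abbreviation Q :: nat where "Q \<equiv> weight_scale m K"

definition G :: "nat \<Rightarrow> nat \<Rightarrow> int" where
  "G i j = \<lfloor>real Q * P j i / real h\<rfloor>"

text \<open>The margin \<open>2 * E\<close> absorbs a rounding error of up to \<open>E\<close>: a
  reported violation is real by at least \<open>1 / K\<close>, and an unreported one is at most
  \<open>2 / K\<close>.\<close>

definition violated :: "bool list \<Rightarrow> (nat \<Rightarrow> nat) \<Rightarrow> nat \<Rightarrow> bool" where
  "violated x c i \<longleftrightarrow> \<lfloor>real Q * v0 i\<rfloor> + (\<Sum>j<m. G i j * int (c j))
      < int Q * of_bool (lit i x) - 2 * int E"

text \<open>All constraints found violated in a round are corrected simultaneously, so every test of
  round \<open>t\<close> depends only on tests of earlier rounds.\<close>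

primrec count :: "bool list \<Rightarrow> nat \<Rightarrow> nat \<Rightarrow> nat" where
  "count x 0 = (\<lambda>_. 0)"
| "count x (Suc t) = (\<lambda>j. count x t j + of_bool (violated x (count x t) j))"

definition violation :: "nat \<Rightarrow> nat \<Rightarrow> bool list \<Rightarrow> bool" where
  "violation t i x \<longleftrightarrow> violated x (count x t) i"

definition accept :: "bool list \<Rightarrow> bool" where
  "accept x \<longleftrightarrow> (\<exists>t\<in>{..<T}. \<not> (\<exists>i\<in>{..<m}. violation t i x))"

definition point :: "bool list \<Rightarrow> nat \<Rightarrow> nat \<Rightarrow> real" where
  "point x t i = v0 i + (\<Sum>j<m. real (count x t j) / real h * P j i)"

section \<open>The real iterates and their rounded tests\<close>

lemma h_pos: "h > 0"
  using K_pos by (simp add: step_denominator_def)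

lemma E_pos: "E > 0"
  by (simp add: rounding_error_def)

lemma count_eq_sum: "count x t j = (\<Sum>s<t. of_bool (violation s j x))"
  by (induction t) (simp_all add: violation_def)

lemma count_le: "count x t j \<le> t"
  by (induction t) (auto intro: le_SucI)

lemma point_Suc:
  "point x (Suc t) i = point x t i + (\<Sum>j\<in>{j\<in>{..<m}. violation t j x}. P j i) / real h"
proof -
  have "(\<Sum>j\<in>{j\<in>{..<m}. violation t j x}. P j i) / real h =
      (\<Sum>j<m. (if violation t j x then P j i else 0) / real h)"
    by (subst sum.inter_filter) (simp_all add: sum_divide_distrib)
  moreover have "(\<Sum>j<m. real (count x (Suc t) j) / real h * P j i) =
      (\<Sum>j<m. real (count x t j) / real h * P j i) +
      (\<Sum>j<m. (if violation t j x then P j i else 0) / real h)"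
    unfolding sum.distrib[symmetric]
    by (rule sum.cong) (auto simp: violation_def field_simps add_divide_distrib)
  ultimately show ?thesis by (simp add: point_def)
qed

lemma point_minus_v0_in_span:
  assumes "linear_set V" "D \<subseteq> V"
  shows "(\<lambda>i. point x t i - v0 i) \<in> V"
proof -
  have "(\<lambda>i. \<Sum>j<m. real (count x t j) / real h * P j i) \<in> V"
    by (rule linear_set_sum) (use assms projects_span[OF P] in auto)
  then show ?thesis by (simp add: point_def)
qed

text \<open>Each floor loses at most 1, and the loss in weight \<open>j\<close> is multiplied by a
  nonnegative count of at most \<open>T\<close>.\<close>

lemma rounding:
  fixes x i t
  assumes "t \<le> T"
  defines "z \<equiv> \<lfloor>real Q * v0 i\<rfloor> + (\<Sum>j<m. G i j * int (count x t j))"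
  shows "real_of_int z \<le> real Q * point x t i" "real Q * point x t i \<le> real_of_int z + real E"
proof -
  define r where "r j = real Q * P j i / real h" for j
  have eq: "real Q * point x t i = real Q * v0 i + (\<Sum>j<m. r j * real (count x t j))"
    by (simp add: point_def r_def distrib_left sum_distrib_left ac_simps)
  have z: "real_of_int z = \<lfloor>real Q * v0 i\<rfloor> + (\<Sum>j<m. \<lfloor>r j\<rfloor> * real (count x t j))"
    by (simp add: z_def G_def r_def)
  have "(\<Sum>j<m. \<lfloor>r j\<rfloor> * real (count x t j)) \<le> (\<Sum>j<m. r j * real (count x t j))"
    by (intro sum_mono mult_right_mono) auto
  then show "real_of_int z \<le> real Q * point x t i"
    unfolding eq z by (intro add_mono) auto
  have "r j * real (count x t j) \<le> \<lfloor>r j\<rfloor> * real (count x t j) + real T" for j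
  proof -
    have "r j * real (count x t j) \<le> (\<lfloor>r j\<rfloor> + 1) * real (count x t j)"
      by (intro mult_right_mono) linarith+
    also have "\<dots> = \<lfloor>r j\<rfloor> * real (count x t j) + real (count x t j)"
      by (simp add: algebra_simps)
    finally show ?thesis
      using count_le[of x t j] assms(1) by linarith
  qed
  then have "(\<Sum>j<m. r j * real (count x t j)) \<le> (\<Sum>j<m. \<lfloor>r j\<rfloor> * real (count x t j) + real T)"
    by (intro sum_mono)
  also have "\<dots> = (\<Sum>j<m. \<lfloor>r j\<rfloor> * real (count x t j)) + real m * real T"
    by (simp add: sum.distrib)
  finally show "real Q * point x t i \<le> real_of_int z + real E"
    unfolding eq z rounding_error_def by (simp, linarith)
qed

lemma violation_imp:
  assumes "t \<le> T" "violation t i x"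
  shows "point x t i \<le> of_bool (lit i x) - 1 / real K"
proof -
  have "real_of_int (\<lfloor>real Q * v0 i\<rfloor> + (\<Sum>j<m. G i j * int (count x t j)))
      < real_of_int (int Q * of_bool (lit i x) - 2 * int E)"
    using assms(2) unfolding violation_def violated_def by (simp only: of_int_less_iff)
  with rounding(2)[OF assms(1), where x = x and i = i]
  have "real Q * point x t i \<le> real Q * of_bool (lit i x) - real E" by simp
  also have "\<dots> = real Q * (of_bool (lit i x) - 1 / real K)"
    using K_pos by (simp add: weight_scale_def field_simps)
  finally show ?thesis
    using K_pos E_pos by (simp add: weight_scale_def)
qed

lemma no_violation_imp:
  assumes "t \<le> T" "\<not> violation t i x"
  shows "point x t i \<ge> of_bool (lit i x) - 2 / real K"
proof -
  have "real_of_int (\<lfloor>real Q * v0 i\<rfloor> + (\<Sum>j<m. G i j * int (count x t j)))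
      \<ge> real_of_int (int Q * of_bool (lit i x) - 2 * int E)"
    using assms(2) unfolding violation_def violated_def by (simp only: of_int_le_iff)
  with rounding(1)[OF assms(1), where x = x and i = i]
  have "real Q * point x t i \<ge> real Q * of_bool (lit i x) - 2 * real E" by simp
  moreover have "real Q * of_bool (lit i x) - 2 * real E = real Q * (of_bool (lit i x) - 2 / real K)"
    using K_pos by (simp add: weight_scale_def field_simps)
  ultimately show ?thesis
    using K_pos E_pos by (simp add: weight_scale_def)
qed

lemma accept_sound:
  assumes "accept x"
  shows "\<exists>v. (\<forall>i<m. v i \<ge> of_bool (lit i x) - 2 / real K) \<and>
    (\<forall>V. linear_set V \<longrightarrow> D \<subseteq> V \<longrightarrow> (\<lambda>i. v i - v0 i) \<in> V)"
proof -
  obtain t where "t < T" "\<forall>i<m. \<not> violation t i x"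
    using assms unfolding accept_def by blast
  then show ?thesis
    using no_violation_imp[of t _ x] point_minus_v0_in_span by (intro exI[of _ "point x t"]) auto
qed

text \<open>The difference \<open>d\<close> from the iterate to \<open>p\<close> lies in the span of
  \<open>D\<close>, so its inner product with a projected unit vector \<open>P j\<close> is just
  \<open>d j\<close>, which is at most \<open>- 1 / K\<close> for a violated \<open>j\<close>.
  Moving along these vectors therefore approaches \<open>p\<close>.\<close>

lemma potential_step:
  assumes p_span: "\<And>V. linear_set V \<Longrightarrow> D \<subseteq> V \<Longrightarrow> (\<lambda>i. p i - v0 i) \<in> V"
    and p_ge: "\<And>i. i < m \<Longrightarrow> p i \<ge> of_bool (lit i x)"
    and "t \<le> T" "i0 < m" "violation t i0 x"
  shows "(\<Sum>i<m. (point x (Suc t) i - p i)\<^sup>2) \<le> (\<Sum>i<m. (point x t i - p i)\<^sup>2) - 1 / (real h * real K)"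
proof -
  define J where "J = {j\<in>{..<m}. violation t j x}"
  define d where "d i = point x t i - p i" for i
  define e where "e i = (\<Sum>j\<in>J. P j i)" for i
  have J: "finite J" "J \<subseteq> {..<m}" "i0 \<in> J"
    using assms by (auto simp: J_def)
  have d_repr: "(\<Sum>i<m. P j i * d i) = d j" if "j < m" for j
  proof (rule projects_reproduce[OF P])
    fix V :: "(nat \<Rightarrow> real) set" assume V: "linear_set V" "D \<subseteq> V"
    have "(\<lambda>i. (point x t i - v0 i) + (-1) * (p i - v0 i)) \<in> V"
      by (rule linear_set_add_scale) (use V p_span point_minus_v0_in_span in auto)
    then show "d \<in> V" by (simp add: d_def[abs_def])
  qed (use that in simp)
  have cross: "(\<Sum>i<m. d i * e i) \<le> - real (card J) / real K"
  proof -
    have "(\<Sum>i<m. d i * e i) = (\<Sum>i<m. \<Sum>j\<in>J. P j i * d i)"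
      by (simp add: e_def sum_distrib_left mult.commute)
    also have "\<dots> = (\<Sum>j\<in>J. d j)"
      by (subst sum.swap, rule sum.cong) (use d_repr J in auto)
    also have "\<dots> \<le> (\<Sum>j\<in>J. - (1 / real K))"
    proof (rule sum_mono)
      fix j assume "j \<in> J"
      then show "d j \<le> - (1 / real K)"
        using violation_imp[OF \<open>t \<le> T\<close>, of j x] p_ge[of j] by (auto simp: J_def d_def)
    qed
    finally show ?thesis by simp
  qed
  have square: "(\<Sum>i<m. (e i)\<^sup>2) \<le> real (card J) * real (m + 1)"
  proof -
    have "(\<Sum>i<m. (e i)\<^sup>2) = (\<Sum>i<m. \<Sum>j\<in>J. \<Sum>l\<in>J. P j i * P l i)"
      by (simp add: e_def power2_eq_square sum_product)
    also have "\<dots> = (\<Sum>j\<in>J. \<Sum>l\<in>J. \<Sum>i<m. P j i * P l i)"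
      by (subst sum.swap, rule sum.cong[OF refl], subst sum.swap) simp
    \<comment> \<open>Idempotence makes the Gram matrix of the columns equal to \<open>P\<close>,
      whose entries are at most 1.\<close>
    also have "\<dots> = (\<Sum>j\<in>J. \<Sum>l\<in>J. P l j)"
      by (intro sum.cong refl projects_idem[OF P]) (use J in auto)
    also have "\<dots> \<le> (\<Sum>j\<in>J. \<Sum>l\<in>J. 1)"
    proof (intro sum_mono)
      fix j l assume "j \<in> J" "l \<in> J"
      then have "\<bar>P l j\<bar> \<le> 1"
        using J by (intro projects_abs_le_1[OF _ P]) auto
      then show "P l j \<le> 1" by linarith
    qed
    also have "\<dots> = real (card J) * real (card J)" by simp
    also have "card J \<le> m" using card_mono[of "{..<m}" J] J by simp
    then have "real (card J) * real (card J) \<le> real (card J) * real (m + 1)"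
      by (intro mult_left_mono) auto
    finally show ?thesis .
  qed
  \<comment> \<open>With this step size the quadratic term consumes at most half of the guaranteed
    linear decrease.\<close>
  have hK: "real (m + 1) = real h / real K"
    using K_pos by (simp add: step_denominator_def field_simps)
  have "(\<Sum>i<m. (point x (Suc t) i - p i)\<^sup>2) = (\<Sum>i<m. (d i + e i / real h)\<^sup>2)"
    by (simp add: point_Suc d_def e_def J_def algebra_simps)
  also have "\<dots> = (\<Sum>i<m. (d i)\<^sup>2 + 2 / real h * (d i * e i) + (e i)\<^sup>2 / (real h)\<^sup>2)"
    by (rule sum.cong) (simp_all add: power2_sum power_divide)
  also have "\<dots> = (\<Sum>i<m. (d i)\<^sup>2) + 2 / real h * (\<Sum>i<m. d i * e i) + (\<Sum>i<m. (e i)\<^sup>2) / (real h)\<^sup>2"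
    by (simp add: sum.distrib sum_distrib_left sum_divide_distrib)
  also have "\<dots> \<le> (\<Sum>i<m. (d i)\<^sup>2) + 2 / real h * (- real (card J) / real K)
      + real (card J) * real (m + 1) / (real h)\<^sup>2"
    using cross square h_pos by (intro add_mono mult_left_mono divide_right_mono order_refl) auto
  also have "\<dots> = (\<Sum>i<m. (d i)\<^sup>2) - real (card J) / (real h * real K)"
    unfolding hK using h_pos K_pos by (simp add: field_simps power2_eq_square)
  also have "\<dots> \<le> (\<Sum>i<m. (d i)\<^sup>2) - 1 / (real h * real K)"
  proof -
    have "1 \<le> card J" using J by (metis One_nat_def Suc_leI card_gt_0_iff empty_iff)
    then show ?thesis
      by (simp add: divide_right_mono)
  qed
  finally show ?thesis by (simp add: d_def)
qed

text \<open>Both \<open>v0\<close> and \<open>p\<close> lie in the unit cube, so the potential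
  starts at most \<open>m\<close>; a violation in each of \<open>T\<close> rounds would make it
  negative.\<close>

lemma accept_complete:
  assumes p_span: "\<And>V. linear_set V \<Longrightarrow> D \<subseteq> V \<Longrightarrow> (\<lambda>i. p i - v0 i) \<in> V"
    and p_ge: "\<And>i. i < m \<Longrightarrow> p i \<ge> of_bool (lit i x)"
    and p_le: "\<And>i. i < m \<Longrightarrow> p i \<le> 1"
  shows "accept x"
proof (rule ccontr)
  assume "\<not> accept x"
  then have viol: "\<exists>i0<m. violation t i0 x" if "t < T" for t
    using that unfolding accept_def by auto
  have "(\<Sum>i<m. (point x t i - p i)\<^sup>2) \<le> real m - real t / (real h * real K)" if "t \<le> T" for t
    using that
  proof (induction t)
    case 0
    have "(\<Sum>i<m. (point x 0 i - p i)\<^sup>2) \<le> (\<Sum>i<m. 1)"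
    proof (rule sum_mono)
      fix i assume "i \<in> {..<m}"
      then have "\<bar>v0 i - p i\<bar> \<le> 1"
        using v0[of i] p_ge[of i] p_le[of i] by (auto simp: of_bool_def split: if_splits)
      then show "(point x 0 i - p i)\<^sup>2 \<le> 1"
        by (simp add: point_def abs_square_le_1)
    qed
    then show ?case by simp
  next
    case (Suc t)
    obtain i0 where "i0 < m" "violation t i0 x"
      using viol[of t] Suc.prems by auto
    then have "(\<Sum>i<m. (point x (Suc t) i - p i)\<^sup>2)
        \<le> (\<Sum>i<m. (point x t i - p i)\<^sup>2) - 1 / (real h * real K)"
      using Suc.prems by (intro potential_step[OF p_span p_ge]) auto
    also have "\<dots> \<le> real m - real t / (real h * real K) - 1 / (real h * real K)"
      using Suc by simp
    also have "\<dots> = real m - real (Suc t) / (real h * real K)"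
      by (simp add: add_divide_distrib)
    finally show ?case .
  qed
  from this[of T] have "0 \<le> real m - real T / (real h * real K)"
    using sum_nonneg[of "{..<m}" "\<lambda>i. (point x T i - p i)\<^sup>2"] by simp
  then have "real T \<le> real m * (real h * real K)"
    using h_pos K_pos by (simp add: field_simps)
  then have "T \<le> m * (h * K)"
    by (metis of_nat_le_iff of_nat_mult)
  then show False by (simp add: max_steps_def)
qed

end

subsection \<open>Slack coordinates of an extended formulation\<close>

lemma conv_superset: "s \<in> S \<Longrightarrow> s \<in> conv S"
  unfolding conv_def by (intro CollectI exI[of _ "{s}"] exI[of _ "\<lambda>_. 1"]) auto

text \<open>For a fixed 0/1 vector \<open>x\<close> the l1-distance is affine on the cube. It is at
  least 1 at every other 0/1 vector, hence at every convex combination of them.\<close>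

lemma l1_dist_conv_embed:
  assumes S: "\<And>z. z \<in> S \<Longrightarrow> length z = length x" and "x \<notin> S" and u: "u \<in> conv (embed ` S)"
  shows "1 \<le> (\<Sum>i<length x. if x ! i then 1 - u i else u i)"
proof -
  define l where "l i t = (if x ! i then 1 - t else t)" for i and t :: real
  obtain F w where F: "finite F" "F \<subseteq> embed ` S" "\<And>s. s \<in> F \<Longrightarrow> 0 \<le> w s" "sum w F = 1"
    and u: "u = (\<lambda>i. \<Sum>s\<in>F. w s * s i)"
    using u unfolding conv_def by blast
  have far: "1 \<le> (\<Sum>i<length x. l i (s i))" if "s \<in> F" for s
  proof -
    obtain z where z: "z \<in> S" "s = embed z"
      using F \<open>s \<in> F\<close> by blast
    then have "z \<noteq> x" "length z = length x"
      using S assms(2) by auto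
    then obtain i where i: "i < length x" "z ! i \<noteq> x ! i"
      using nth_equalityI[of z x] by auto
    then have "1 = l i (s i)"
      using z S by (simp add: l_def embed_def)
    also have "\<dots> \<le> (\<Sum>i<length x. l i (s i))"
      by (rule member_le_sum[of i _ "\<lambda>i. l i (s i)"]) (use i z in \<open>auto simp: l_def embed_def\<close>)
    finally show ?thesis .
  qed
  have lin: "l i (u i) = (\<Sum>s\<in>F. w s * l i (s i))" for i
    using F(4) by (simp add: l_def u algebra_simps sum_subtractf)
  have "1 = (\<Sum>s\<in>F. w s * 1)" using F(4) by simp
  also have "\<dots> \<le> (\<Sum>s\<in>F. w s * (\<Sum>i<length x. l i (s i)))"
    by (intro sum_mono mult_left_mono far F)
  also have "\<dots> = (\<Sum>i<length x. l i (u i))"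
    unfolding lin by (simp add: sum_distrib_left) (rule sum.swap)
  finally show ?thesis by (simp add: l_def)
qed

text \<open>The lower bounds for the three blocks of coordinates: \<open>x\<close>, its complement,
  and 0 for the slacks.\<close>

definition literal :: "nat \<Rightarrow> nat \<Rightarrow> bool list \<Rightarrow> bool" where
  "literal n i x = (if i < n then x ! i else if i < 2 * n then \<not> x ! (i - n) else False)"

locale extended_formulation =
  fixes n q :: nat
    and S :: "bool list set"
    and A B :: "nat \<Rightarrow> nat \<Rightarrow> real"
    and b :: "nat \<Rightarrow> real"
  assumes length_S: "\<And>z. z \<in> S \<Longrightarrow> length z = n"
    and S_nonempty: "S \<noteq> {}"
    and conv_eq: "conv (embed ` S) = {x. (\<forall>i\<ge>n. x i = 0) \<and>
          (\<exists>y. \<forall>j<q. (\<Sum>i<n. A j i * x i) + (\<Sum>k<q. B j k * y k) \<le> b j)}"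
begin

lemma finite_S: "finite S"
proof (rule finite_subset)
  show "S \<subseteq> {z. set z \<subseteq> UNIV \<and> length z = n}" using length_S by auto
  show "finite {z :: bool list. set z \<subseteq> UNIV \<and> length z = n}"
    by (rule finite_lists_length_eq) simp
qed

definition witness :: "bool list \<Rightarrow> nat \<Rightarrow> real" where
  "witness z = (SOME y. \<forall>j<q. (\<Sum>i<n. A j i * embed z i) + (\<Sum>k<q. B j k * y k) \<le> b j)"

definition slack :: "bool list \<Rightarrow> nat \<Rightarrow> real" where
  "slack z j = b j - (\<Sum>i<n. A j i * embed z i) - (\<Sum>k<q. B j k * witness z k)"

definition max_slack :: "nat \<Rightarrow> real" where
  "max_slack j = Max ((\<lambda>z. slack z j) ` S)"

text \<open>Slacks that vanish on all of \<open>S\<close> are normalised to \<open>0 / 0 = 0\<close>.\<close>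

definition vertex :: "bool list \<Rightarrow> nat \<Rightarrow> real" where
  "vertex z i = (if i < n then embed z i else if i < 2 * n then 1 - embed z (i - n)
     else slack z (i - 2 * n) / max_slack (i - 2 * n))"

text \<open>The last block of \<open>v\<close> holds normalised slacks, so multiplication by
  \<open>max_slack j\<close> restores the true slack. The right-hand side is a parameter to cover
  both the system itself and its homogeneous form.\<close>

definition satisfies :: "(nat \<Rightarrow> real) \<Rightarrow> (nat \<Rightarrow> real) \<Rightarrow> (nat \<Rightarrow> real) \<Rightarrow> bool" where
  "satisfies v y c \<longleftrightarrow> (\<forall>j<q. (\<Sum>i<n. A j i * v i) + (\<Sum>k<q. B j k * y k)
      + max_slack j * v (2 * n + j) = c j)"

text \<open>The homogeneous version of the equations valid at all vertices, with \<open>y\<close>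
  projected away. Soundness only uses that this linear set contains all differences of
  vertices.\<close>

definition directions :: "(nat \<Rightarrow> real) set" where
  "directions = {d. (\<forall>i<n. d i + d (n + i) = 0) \<and> (\<exists>y. satisfies d y (\<lambda>_. 0))}"

lemma satisfies_add_scale:
  assumes "satisfies v y c" "satisfies v' y' c'"
  shows "satisfies (\<lambda>i. v i + a * v' i) (\<lambda>i. y i + a * y' i) (\<lambda>i. c i + a * c' i)"
proof -
  have *: "(\<Sum>i\<in>I. f i * (g i + a * g' i)) = (\<Sum>i\<in>I. f i * g i) + a * (\<Sum>i\<in>I. f i * g' i)"
    for I :: "nat set" and f g g' :: "nat \<Rightarrow> real"
    by (simp add: algebra_simps sum.distrib sum_distrib_left)
  show ?thesis
    unfolding satisfies_def
  proof (intro allI impI)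
    fix j assume "j < q"
    have "(\<Sum>i<n. A j i * (v i + a * v' i)) + (\<Sum>k<q. B j k * (y k + a * y' k))
        + max_slack j * (v (2 * n + j) + a * v' (2 * n + j)) =
      ((\<Sum>i<n. A j i * v i) + (\<Sum>k<q. B j k * y k) + max_slack j * v (2 * n + j))
      + a * ((\<Sum>i<n. A j i * v' i) + (\<Sum>k<q. B j k * y' k) + max_slack j * v' (2 * n + j))"
      unfolding * by (simp only: distrib_left mult.left_commute add.commute add.left_commute)
    also have "\<dots> = c j + a * c' j"
      using assms \<open>j < q\<close> unfolding satisfies_def by simp
    finally show "(\<Sum>i<n. A j i * (v i + a * v' i)) + (\<Sum>k<q. B j k * (y k + a * y' k))
        + max_slack j * (v (2 * n + j) + a * v' (2 * n + j)) = c j + a * c' j" .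
  qed
qed

lemma satisfies_zero: "satisfies (\<lambda>_. 0) (\<lambda>_. 0) (\<lambda>_. 0)"
  by (simp add: satisfies_def)

lemma satisfies_sum:
  assumes "finite J" "\<And>l. l \<in> J \<Longrightarrow> satisfies (v l) (y l) c"
  shows "satisfies (\<lambda>i. \<Sum>l\<in>J. v l i) (\<lambda>i. \<Sum>l\<in>J. y l i) (\<lambda>i. real (card J) * c i)"
  using assms
proof (induction J)
  case empty
  show ?case using satisfies_zero by simp
next
  case (insert l J)
  then have "satisfies (\<lambda>i. v l i + 1 * (\<Sum>l\<in>J. v l i)) (\<lambda>i. y l i + 1 * (\<Sum>l\<in>J. y l i))
      (\<lambda>i. c i + 1 * (real (card J) * c i))"
    by (intro satisfies_add_scale) auto
  then show ?case using insert.hyps by (simp add: algebra_simps)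
qed

lemma linear_set_directions: "linear_set directions"
proof -
  have "(\<lambda>i. u i + a * v i) \<in> directions" if uv: "u \<in> directions" "v \<in> directions" for u v a
  proof -
    obtain y y' where "satisfies u y (\<lambda>_. 0)" "satisfies v y' (\<lambda>_. 0)"
      using uv by (auto simp: directions_def)
    from satisfies_add_scale[OF this, of a]
    have "\<exists>y. satisfies (\<lambda>i. u i + a * v i) y (\<lambda>_. 0)" by auto
    moreover have "(u i + a * v i) + (u (n + i) + a * v (n + i)) = 0" if "i < n" for i
    proof -
      have "(u i + a * v i) + (u (n + i) + a * v (n + i)) = (u i + u (n + i)) + a * (v i + v (n + i))"
        by (simp add: algebra_simps)
      moreover have "u i + u (n + i) = 0" "v i + v (n + i) = 0"
        using uv that by (simp_all add: directions_def)
      ultimately show ?thesis by simp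
    qed
    ultimately show ?thesis by (simp add: directions_def)
  qed
  moreover have "(\<lambda>i. 0) \<in> directions"
    using satisfies_zero by (auto simp: directions_def)
  ultimately show ?thesis by (simp add: linear_set_def)
qed

section \<open>Slacks and vertices of the members\<close>

lemma slack_nonneg:
  assumes "z \<in> S" "j < q"
  shows "0 \<le> slack z j"
proof -
  have "embed z \<in> conv (embed ` S)"
    using assms by (intro conv_superset) blast
  then have "\<exists>y. \<forall>j<q. (\<Sum>i<n. A j i * embed z i) + (\<Sum>k<q. B j k * y k) \<le> b j"
    unfolding conv_eq by blast
  from someI_ex[OF this] assms(2) show ?thesis
    unfolding slack_def witness_def by fastforce
qed

lemma slack_le_max: "z \<in> S \<Longrightarrow> slack z j \<le> max_slack j"
  unfolding max_slack_def using finite_S by simp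

lemma max_slack_attained: "\<exists>z\<in>S. slack z j = max_slack j"
proof -
  have "max_slack j \<in> (\<lambda>z. slack z j) ` S"
    unfolding max_slack_def using finite_S S_nonempty by (intro Max_in) auto
  then show ?thesis by auto
qed

lemma max_slack_nonneg: "j < q \<Longrightarrow> 0 \<le> max_slack j"
  using max_slack_attained[of j] slack_nonneg by metis

text \<open>If the maximum is 0, nonnegativity forces the slack itself to be 0, so the normalisation
  loses nothing.\<close>

lemma vertex_slack:
  assumes "z \<in> S" "j < q"
  shows "max_slack j * vertex z (2 * n + j) = slack z j"
proof (cases "max_slack j = 0")
  case True
  then show ?thesis using slack_nonneg[OF assms] slack_le_max[OF assms(1), of j] by simp
qed (simp add: vertex_def)

lemma vertex_bounds:
  assumes "z \<in> S" "i < 2 * n + q"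
  shows "0 \<le> vertex z i" "vertex z i \<le> 1"
proof -
  have "0 \<le> slack z (i - 2 * n) / max_slack (i - 2 * n)"
    "slack z (i - 2 * n) / max_slack (i - 2 * n) \<le> 1" if "\<not> i < 2 * n"
  proof -
    have "i - 2 * n < q" using assms that by linarith
    then have "0 \<le> slack z (i - 2 * n)" "slack z (i - 2 * n) \<le> max_slack (i - 2 * n)"
      using slack_nonneg slack_le_max assms(1) by auto
    then show "0 \<le> slack z (i - 2 * n) / max_slack (i - 2 * n)"
      "slack z (i - 2 * n) / max_slack (i - 2 * n) \<le> 1"
      by (cases "max_slack (i - 2 * n) = 0"; simp add: divide_le_eq_1)+
  qed
  then show "0 \<le> vertex z i" "vertex z i \<le> 1"
    by (auto simp: vertex_def embed_def)
qed

lemma vertex_satisfies: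
  assumes "z \<in> S"
  shows "satisfies (vertex z) (witness z) b"
proof -
  have "(\<Sum>i<n. A j i * vertex z i) = (\<Sum>i<n. A j i * embed z i)" for j
    by (simp add: vertex_def)
  then show ?thesis
    unfolding satisfies_def using vertex_slack[OF assms] by (simp add: slack_def)
qed

lemma vertex_diff_in_directions:
  assumes "z \<in> S" "z' \<in> S"
  shows "(\<lambda>i. vertex z i - vertex z' i) \<in> directions"
  using satisfies_add_scale[OF vertex_satisfies[OF assms(1)] vertex_satisfies[OF assms(2)], of "-1"]
  by (auto simp: directions_def vertex_def)

lemma vertex_ge_literal:
  assumes "x \<in> S" "i < 2 * n + q"
  shows "of_bool (literal n i x) \<le> vertex x i"
  using vertex_bounds(1)[OF assms] length_S[OF assms(1)]
  by (auto simp: literal_def vertex_def embed_def)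

text \<open>Mixing an approximately feasible \<open>v\<close> with vertices at which the slacks are maximal repairs
  its negative slacks. The first \<open>n\<close> coordinates of the result lie in the convex hull of \<open>S\<close>, but
  still closer to \<open>x\<close> than points outside \<open>S\<close> can be.\<close>

lemma approx_feasible_imp_mem:
  assumes x: "length x = n" and "z0 \<in> S"
    and dir: "(\<lambda>i. v i - vertex z0 i) \<in> directions"
    and ge: "\<And>i. i < 2 * n + q \<Longrightarrow> of_bool (literal n i x) - \<epsilon> \<le> v i"
    and eps: "0 \<le> \<epsilon>" "\<epsilon> * (real n * (real q + 1)) < 1"
  shows "x \<in> S"
proof (rule ccontr)
  assume "x \<notin> S"
  obtain top where top: "\<And>j. top j \<in> S" "\<And>j. slack (top j) j = max_slack j"
    using max_slack_attained by metis
  \<comment> \<open>The total weight when \<open>v\<close> gets weight 1 and each of the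
    \<open>q\<close> maximal vertices gets weight \<open>\<epsilon>\<close>; \<open>u\<close> is the
    resulting average.\<close>
  define c where "c = 1 + \<epsilon> * real q"
  have c: "c \<ge> 1" using eps by (simp add: c_def)
  define u where "u i = (v i + \<epsilon> * (\<Sum>l<q. vertex (top l) i)) / c" for i
  obtain y where y: "satisfies (\<lambda>i. v i - vertex z0 i) y (\<lambda>_. 0)"
    using dir by (auto simp: directions_def)
  from satisfies_add_scale[OF y vertex_satisfies[OF \<open>z0 \<in> S\<close>], of 1]
  have "satisfies v (\<lambda>k. y k + witness z0 k) b" by simp
  moreover have "satisfies (\<lambda>i. \<Sum>l<q. vertex (top l) i) (\<lambda>i. \<Sum>l<q. witness (top l) i)
      (\<lambda>i. real (card {..<q}) * b i)"
    by (rule satisfies_sum) (use top vertex_satisfies in auto)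
  ultimately have "satisfies (\<lambda>i. v i + \<epsilon> * (\<Sum>l<q. vertex (top l) i))
      (\<lambda>k. y k + witness z0 k + \<epsilon> * (\<Sum>l<q. witness (top l) k)) (\<lambda>i. b i + \<epsilon> * (real (card {..<q}) * b i))"
    by (rule satisfies_add_scale)
  from satisfies_add_scale[OF satisfies_zero this, of "1 / c"]
  obtain y' where "satisfies u y' (\<lambda>i. (b i + \<epsilon> * (real q * b i)) / c)"
    by (auto simp: u_def[abs_def])
  moreover have "(b i + \<epsilon> * (real q * b i)) / c = b i" for i
  proof -
    have "b i + \<epsilon> * (real q * b i) = b i * c" by (simp add: c_def algebra_simps)
    then show ?thesis using c by simp
  qed
  ultimately have u_sat: "satisfies u y' b" by simp
  \<comment> \<open>The vertex \<open>top j\<close> has normalised slack 1 in row \<open>j\<close>,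
    so its share \<open>\<epsilon>\<close> cancels a deficit of up to \<open>\<epsilon>\<close> in
    \<open>v\<close>; the other vertices contribute nonnegatively.\<close>
  have u_slack: "0 \<le> max_slack j * u (2 * n + j)" if j: "j < q" for j
  proof (cases "max_slack j = 0")
    case False
    then have "vertex (top j) (2 * n + j) = 1"
      using top by (simp add: vertex_def)
    then have "1 \<le> (\<Sum>l<q. vertex (top l) (2 * n + j))"
      using member_le_sum[of j "{..<q}" "\<lambda>l. vertex (top l) (2 * n + j)"] j vertex_bounds(1) top
      by simp
    then have "\<epsilon> * 1 \<le> \<epsilon> * (\<Sum>l<q. vertex (top l) (2 * n + j))"
      using eps by (intro mult_left_mono) auto
    moreover have "- \<epsilon> \<le> v (2 * n + j)"
      using ge[of "2 * n + j"] j by (simp add: literal_def)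
    ultimately have "0 \<le> u (2 * n + j)"
      using c by (simp add: u_def)
    then show ?thesis using max_slack_nonneg[OF j] by simp
  qed simp
  define w where "w i = (if i < n then u i else 0)" for i
  have "w \<in> conv (embed ` S)"
    unfolding conv_eq
  proof (intro CollectI conjI exI[of _ y'] allI impI)
    fix j assume j: "j < q"
    have "(\<Sum>i<n. A j i * w i) = (\<Sum>i<n. A j i * u i)"
      by (simp add: w_def)
    moreover have "(\<Sum>i<n. A j i * u i) + (\<Sum>k<q. B j k * y' k) + max_slack j * u (2 * n + j) = b j"
      using u_sat j by (simp add: satisfies_def)
    ultimately show "(\<Sum>i<n. A j i * w i) + (\<Sum>k<q. B j k * y' k) \<le> b j"
      using u_slack[OF j] by linarith
  qed (simp add: w_def)
  then have "1 \<le> (\<Sum>i<n. if x ! i then 1 - w i else w i)"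
    using l1_dist_conv_embed[of S x w] length_S \<open>x \<notin> S\<close> x by simp
  also have "\<dots> \<le> (\<Sum>i<n. \<epsilon> * (real q + 1))"
  proof (rule sum_mono)
    fix i assume "i \<in> {..<n}"
    then have i: "i < n" by simp
    define s where "s = (\<Sum>l<q. vertex (top l) i)"
    have s: "0 \<le> s" "s \<le> real q"
      using sum_nonneg[of "{..<q}" "\<lambda>l. vertex (top l) i"]
        sum_bounded_above[of "{..<q}" "\<lambda>l. vertex (top l) i" 1] vertex_bounds top i
      by (auto simp: s_def)
    \<comment> \<open>Complementary coordinates turn the lower bound at \<open>n + i\<close> into an
      upper bound at \<open>i\<close>.\<close>
    have "v i + v (n + i) = 1"
      using dir i by (simp add: directions_def vertex_def algebra_simps)
    then have v: "x ! i \<Longrightarrow> 1 - v i \<le> \<epsilon>" "\<not> x ! i \<Longrightarrow> v i \<le> \<epsilon>"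
      using ge[of i] ge[of "n + i"] i by (auto simp: literal_def)
    have step: "c * (if x ! i then 1 - u i else u i) \<le> \<epsilon> * (real q + 1)"
    proof (cases "x ! i")
      case True
      have "c * (1 - u i) = 1 - v i + \<epsilon> * (real q - s)"
        using c by (simp add: u_def s_def c_def field_simps)
      also have "\<dots> \<le> \<epsilon> + \<epsilon> * real q"
        using v(1)[OF True] s eps by (intro add_mono mult_left_mono) auto
      finally show ?thesis using True by (simp add: algebra_simps)
    next
      case False
      have "c * u i = v i + \<epsilon> * s"
        using c by (simp add: u_def s_def)
      also have "\<dots> \<le> \<epsilon> + \<epsilon> * real q"
        using v(2)[OF False] s eps by (intro add_mono mult_left_mono) auto
      finally show ?thesis using False by (simp add: algebra_simps)
    qed
    \<comment> \<open>Dropping the factor \<open>c \<ge> 1\<close> is legitimate only for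
      nonnegative \<open>t\<close>; a negative \<open>t\<close> meets the bound trivially.\<close>
    define t where "t = (if x ! i then 1 - u i else u i)"
    have "t \<le> \<epsilon> * (real q + 1)"
    proof (cases "0 \<le> t")
      case True
      then have "1 * t \<le> c * t" using c by (intro mult_right_mono) auto
      then show ?thesis using step by (simp add: t_def)
    next
      case False
      have "0 \<le> \<epsilon> * (real q + 1)" using eps(1) by simp
      then show ?thesis using False by linarith
    qed
    then show "(if x ! i then 1 - w i else w i) \<le> \<epsilon> * (real q + 1)"
      using i by (cases "x ! i") (simp_all add: w_def t_def)
  qed
  also have "\<dots> < 1"
    using eps(2) by (simp add: algebra_simps)
  finally show False by simp
qed

text \<open>The value of \<open>K\<close> makes the accepted error \<open>2 / K\<close> just small
  enough for approximate feasibility to imply membership. For a member \<open>x\<close>, the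
  feasible point required for completeness is \<open>vertex x\<close>.\<close>

lemma perceptron_exists:
  defines "K \<equiv> 2 * n * (q + 1) + 1"
  shows "\<exists>D P v0. perceptron (2 * n + q) K D P v0 \<and>
    (\<forall>x. length x = n \<longrightarrow> perceptron.accept (2 * n + q) K P v0 (literal n) x \<longleftrightarrow> x \<in> S)"
proof -
  obtain z0 where z0: "z0 \<in> S" using S_nonempty by blast
  define D where "D = (\<lambda>z i. vertex z i - vertex z0 i) ` S"
  have "finite D" using finite_S by (simp add: D_def)
  then obtain P where P: "projects {..<2 * n + q} D P"
    using projects_exists[of "{..<2 * n + q}" D] by auto
  interpret perceptron "2 * n + q" K D P "vertex z0" "literal n"
    by unfold_locales (use P z0 vertex_bounds in \<open>auto simp: K_def\<close>)
  have "accept x \<longleftrightarrow> x \<in> S" if x: "length x = n" for x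
  proof
    assume "accept x"
    then obtain v where ge: "\<forall>i<2 * n + q. of_bool (literal n i x) - 2 / real K \<le> v i"
      and span: "\<forall>V. linear_set V \<longrightarrow> D \<subseteq> V \<longrightarrow> (\<lambda>i. v i - vertex z0 i) \<in> V"
      using accept_sound by blast
    have "D \<subseteq> directions"
      using z0 vertex_diff_in_directions by (auto simp: D_def)
    then have dir: "(\<lambda>i. v i - vertex z0 i) \<in> directions"
      using span linear_set_directions by blast
    have "2 * (real n * (real q + 1)) < real K"
      by (simp add: K_def algebra_simps)
    then have "2 / real K * (real n * (real q + 1)) < 1"
      using K_pos by (simp add: divide_simps)
    then show "x \<in> S"
      using ge by (intro approx_feasible_imp_mem[OF x z0 dir, of "2 / real K"]) auto
  next
    assume "x \<in> S"
    then show "accept x"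
      using vertex_ge_literal vertex_bounds
      by (intro accept_complete[of "vertex x"]) (auto simp: D_def)
  qed
  then show ?thesis
    using perceptron_axioms by blast
qed

end

subsection \<open>The circuit\<close>

text \<open>The cost of all thresholds over at most \<open>N\<close> earlier tests with weights up
  to \<open>weight_scale\<close>, plus two negations and a four-gate selection.\<close>

definition violation_cost :: "nat \<Rightarrow> nat \<Rightarrow> nat" where
  "violation_cost m K = (let N = max_steps m K * m
     in N * ((2 * N * weight_scale m K + 1) * 4) + 6)"

context perceptron
begin

abbreviation cost :: nat where "cost \<equiv> violation_cost m K"

lemma G_bound:
  assumes "i < m" "j < m"
  shows "\<bar>G i j\<bar> \<le> int Q"
proof -
  define r where "r = real Q * P j i / real h"
  have "\<bar>P j i\<bar> \<le> 1"
    using projects_abs_le_1[OF _ P] assms by simp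
  then have "real Q * \<bar>P j i\<bar> \<le> real Q * real h"
    using h_pos by (intro mult_left_mono) auto
  then have "\<bar>r\<bar> \<le> real Q"
    using h_pos by (simp add: r_def abs_mult divide_le_eq)
  then have "- int Q \<le> \<lfloor>r\<rfloor>" "\<lfloor>r\<rfloor> \<le> int Q"
    by linarith+
  then show ?thesis by (simp add: G_def r_def)
qed

text \<open>Expanding the counts into earlier test results leaves an integer-weighted sum of bits.
  The literal only selects between two thresholds, and the strict test is a negated
  threshold.\<close>

lemma violation_eq_threshold:
  fixes t i
  defines "th \<equiv> threshold ({..<t} \<times> {..<m}) (\<lambda>(s, j). G i j) (\<lambda>(s, j). violation s j)"
    and "g \<equiv> \<lfloor>real Q * v0 i\<rfloor>"
  shows "violation t i = (\<lambda>x. if lit i x then \<not> th (int Q - 2 * int E - g) x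
      else \<not> th (- 2 * int E - g) x)"
proof
  fix x
  have "(\<Sum>j<m. G i j * int (count x t j)) = (\<Sum>j<m. \<Sum>s<t. G i j * of_bool (violation s j x))"
    by (simp only: count_eq_sum of_nat_sum of_nat_of_bool sum_distrib_left)
  also have "\<dots> = (\<Sum>(s, j)\<in>{..<t} \<times> {..<m}. G i j * of_bool (violation s j x))"
    by (subst sum.swap) (simp only: sum.cartesian_product)
  finally have eq: "(\<Sum>a\<in>{..<t} \<times> {..<m}. (case a of (s, j) \<Rightarrow> G i j) *
      of_bool ((case a of (s, j) \<Rightarrow> violation s j) x)) = (\<Sum>j<m. G i j * int (count x t j))"
    by (simp add: case_prod_unfold)
  show "violation t i x = (if lit i x then \<not> th (int Q - 2 * int E - g) x
      else \<not> th (- 2 * int E - g) x)"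
    unfolding th_def threshold_def eq g_def violation_def violated_def by auto
qed

lemma computes_violation:
  assumes "t \<le> T" "i < m" "computes n k F"
    and const_mem: "(\<lambda>x. True) \<in> F" "(\<lambda>x. False) \<in> F" and "lit i \<in> F"
    and "\<And>s j. s < t \<Longrightarrow> j < m \<Longrightarrow> violation s j \<in> F"
  shows "computes n (k + cost) (insert (violation t i) F)"
proof -
  define A where "A = {..<t} \<times> {..<m}"
  define th where "th = threshold A (\<lambda>(s, j). G i j) (\<lambda>(s, j). violation s j)"
  define a where "a = int Q - 2 * int E - \<lfloor>real Q * v0 i\<rfloor>"
  define b where "b = - 2 * int E - \<lfloor>real Q * v0 i\<rfloor>"
  have A: "finite A" "card A \<le> T * m"
    using assms(1) by (auto simp: A_def card_cartesian_product)
  have "computes n (k + card A * ((2 * (T * m) * Q + 1) * 4)) (F \<union> range th)"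
    unfolding th_def
    by (rule computes_threshold) (use A assms G_bound in \<open>auto simp: A_def\<close>)
  then have "computes n (k + T * m * ((2 * (T * m) * Q + 1) * 4)) (F \<union> range th)"
    by (rule computes_mono) (use A in auto)
  then have "computes n (Suc (k + T * m * ((2 * (T * m) * Q + 1) * 4)))
      (insert (\<lambda>x. \<not> th a x) (F \<union> range th))"
    by (rule computes_not) simp
  then have "computes n (Suc (Suc (k + T * m * ((2 * (T * m) * Q + 1) * 4))))
      (insert (\<lambda>x. \<not> th b x) (insert (\<lambda>x. \<not> th a x) (F \<union> range th)))"
    by (rule computes_not) simp
  then have "computes n (Suc (Suc (k + T * m * ((2 * (T * m) * Q + 1) * 4))) + 4)
      (insert (\<lambda>x. if lit i x then \<not> th a x else \<not> th b x)
        (insert (\<lambda>x. \<not> th b x) (insert (\<lambda>x. \<not> th a x) (F \<union> range th))))"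
    by (rule computes_if) (use assms in auto)
  then have "computes n (k + cost) (insert (\<lambda>x. if lit i x then \<not> th a x else \<not> th b x) F)"
    by (rule computes_mono) (auto simp: violation_cost_def Let_def)
  moreover have "(\<lambda>x. if lit i x then \<not> th a x else \<not> th b x) = violation t i"
    unfolding th_def A_def a_def b_def by (rule violation_eq_threshold[symmetric])
  ultimately show ?thesis by simp
qed

text \<open>Rounds are evaluated in order; all \<open>m\<close> tests of a round use only results of
  earlier rounds, at the same cost bound each.\<close>

lemma computes_violations:
  assumes "t \<le> T" "computes n k F"
    and const_mem: "(\<lambda>x. True) \<in> F" "(\<lambda>x. False) \<in> F" and "\<And>i. i < m \<Longrightarrow> lit i \<in> F"
  shows "computes n (k + t * (m * cost)) (F \<union> {violation s j |s j. s < t \<and> j < m})"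
  using assms(1)
proof (induction t)
  case 0
  then show ?case using assms(2) by simp
next
  case (Suc t)
  define F1 where "F1 = F \<union> {violation s j |s j. s < t \<and> j < m}"
  have "computes n (k + t * (m * cost) + card {..<m} * cost) (F1 \<union> violation t ` {..<m})"
  proof (rule computes_image)
    show "computes n (k + t * (m * cost)) F1"
      unfolding F1_def using Suc by simp
    fix i l F' assume i: "i \<in> {..<m}" and F': "F1 \<subseteq> F'" "computes n l F'"
    have "violation s j \<in> F'" if "s < t" "j < m" for s j
      using that F'(1) by (auto simp: F1_def)
    moreover have "F \<subseteq> F'" using F'(1) by (simp add: F1_def)
    ultimately show "computes n (l + cost) (insert (violation t i) F')"
      using i Suc.prems F'(2) assms(3-5) by (intro computes_violation) auto
  qed simp
  then show ?case
    by (rule computes_mono) (auto simp: F1_def less_Suc_eq)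
qed

lemma computes_accept:
  assumes "computes n k F"
    and const_mem: "(\<lambda>x. True) \<in> F" "(\<lambda>x. False) \<in> F" and "\<And>i. i < m \<Longrightarrow> lit i \<in> F"
  shows "computes n (k + T * (m * cost) + T * (m + 2) + T + 1) {accept}"
proof -
  define F1 where "F1 = F \<union> {violation s j |s j. s < T \<and> j < m}"
  define halts where "halts t x = (\<not> (\<exists>i\<in>{..<m}. violation t i x))" for t x
  have "computes n (k + T * (m * cost)) F1"
    unfolding F1_def using assms by (intro computes_violations) auto
  then have "computes n (k + T * (m * cost) + card {..<T} * (m + 2)) (F1 \<union> halts ` {..<T})"
  proof (rule computes_image[rotated])
    fix t l F' assume t: "t \<in> {..<T}" and F': "F1 \<subseteq> F'" "computes n l F'"
    have "violation t i \<in> F'" if "i \<in> {..<m}" for i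
      using that t F'(1) by (auto simp: F1_def)
    then have "computes n (l + card {..<m} + 1) (insert (\<lambda>x. \<exists>i\<in>{..<m}. violation t i x) F')"
      by (intro computes_Bex F'(2)) auto
    from computes_not[OF this, of "\<lambda>x. \<exists>i\<in>{..<m}. violation t i x"]
    have "computes n (Suc (l + card {..<m} + 1))
        (insert (halts t) (insert (\<lambda>x. \<exists>i\<in>{..<m}. violation t i x) F'))"
      by (simp add: halts_def[abs_def])
    then show "computes n (l + (m + 2)) (insert (halts t) F')"
      by (rule computes_mono) auto
  qed simp
  then have "computes n (k + T * (m * cost) + card {..<T} * (m + 2) + card {..<T} + 1)
      (insert (\<lambda>x. \<exists>t\<in>{..<T}. halts t x) (F1 \<union> halts ` {..<T}))"
    by (intro computes_Bex) auto
  moreover have "(\<lambda>x. \<exists>t\<in>{..<T}. halts t x) = accept"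
    by (simp add: fun_eq_iff accept_def halts_def)
  ultimately show ?thesis
    by (simp add: computes_mono)
qed

end

lemma computes_literals:
  "computes n (2 + (2 * n + q) * 2)
    ({\<lambda>x. True, \<lambda>x. False} \<union> literal n ` {..<2 * n + q})"
proof -
  have "computes n (2 + card {..<2 * n + q} * 2)
      ({\<lambda>x. True, \<lambda>x. False} \<union> literal n ` {..<2 * n + q})"
  proof (rule computes_image)
    show "computes n 2 {\<lambda>x. True, \<lambda>x. False}"
      using computes_const[OF computes_const[OF computes_empty, of n False], of True]
      by (simp add: numeral_2_eq_2)
    fix i l F' assume F': "{\<lambda>x. True, \<lambda>x. False} \<subseteq> F'" "computes n l F'"
    consider "i < n" | "n \<le> i" "i < 2 * n" | "2 * n \<le> i" by linarith
    then show "computes n (l + 2) (insert (literal n i) F')"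
    proof cases
      case 1
      then have "literal n i = (\<lambda>x. x ! i)"
        by (simp add: literal_def fun_eq_iff)
      then show ?thesis
        using computes_mono[OF computes_input[OF F'(2) 1]] by simp
    next
      case 2
      then have "literal n i = (\<lambda>x. \<not> x ! (i - n))"
        by (simp add: literal_def fun_eq_iff)
      moreover have "computes n (Suc l) (insert (\<lambda>x. x ! (i - n)) F')"
        by (rule computes_input[OF F'(2)]) (use 2 in linarith)
      from computes_not[OF this, of "\<lambda>x. x ! (i - n)"]
      have "computes n (l + 2) (insert (\<lambda>x. \<not> x ! (i - n)) (insert (\<lambda>x. x ! (i - n)) F'))"
        by simp
      then have "computes n (l + 2) (insert (\<lambda>x. \<not> x ! (i - n)) F')"
        by (rule computes_mono) auto
      ultimately show ?thesis by simp
    next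
      case 3
      then have "literal n i = (\<lambda>x. False)"
        by (simp add: literal_def fun_eq_iff)
      then show ?thesis
        using computes_mono[OF F'(2)] F'(1) by (simp add: insert_absorb)
    qed
  qed simp
  then show ?thesis by simp
qed

text \<open>The terms pay for constants, literals, tests, halting checks and the final disjunction;
  the closing 2 is the disjunction's constant gate and the copied output gate.\<close>

definition circuit_size :: "nat \<Rightarrow> nat \<Rightarrow> nat" where
  "circuit_size n q = (let m = 2 * n + q; K = 2 * n * (q + 1) + 1; T = max_steps m K in
     2 + m * 2 + T * (m * violation_cost m K) + T * (m + 2) + T + 2)"

lemma (in extended_formulation) circuit_exists:
  "\<exists>C. circuit_wf n C \<and> length C \<le> circuit_size n q \<and>
     (\<forall>x. length x = n \<longrightarrow> circuit_out C x \<longleftrightarrow> x \<in> S)"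
proof -
  define K where "K = 2 * n * (q + 1) + 1"
  obtain D P v0 where per: "perceptron (2 * n + q) K D P v0"
    and accept: "\<And>x. length x = n \<Longrightarrow>
      perceptron.accept (2 * n + q) K P v0 (literal n) x \<longleftrightarrow> x \<in> S"
    using perceptron_exists unfolding K_def by blast
  interpret perceptron "2 * n + q" K D P v0 "literal n"
    by (rule per)
  have "computes n (2 + (2 * n + q) * 2 + T * ((2 * n + q) * cost) + T * (2 * n + q + 2) + T + 1) {accept}"
    by (rule computes_accept[OF computes_literals]) auto
  from computes_imp_circuit[OF this, of accept] show ?thesis
    using accept by (auto simp: circuit_size_def Let_def K_def)
qed

section \<open>Polynomial bounds on the circuit size\<close>

definition polynomial_fun :: "(nat \<Rightarrow> nat) \<Rightarrow> bool" where
  "polynomial_fun f \<longleftrightarrow> (\<exists>p. \<forall>n. f n = poly p n)"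

lemma polynomial_fun_poly: "polynomial_fun (poly p)"
  unfolding polynomial_fun_def by blast

lemma polynomial_fun_const: "polynomial_fun (\<lambda>_. c)"
  unfolding polynomial_fun_def by (intro exI[of _ "[:c:]"]) simp

lemma polynomial_fun_ident: "polynomial_fun (\<lambda>n. n)"
  unfolding polynomial_fun_def by (intro exI[of _ "[:0, 1:]"]) simp

lemma polynomial_fun_add:
  assumes "polynomial_fun f" "polynomial_fun g"
  shows "polynomial_fun (\<lambda>n. f n + g n)"
proof -
  obtain p p' where "\<forall>n. f n = poly p n" "\<forall>n. g n = poly p' n"
    using assms unfolding polynomial_fun_def by blast
  then show ?thesis
    unfolding polynomial_fun_def by (intro exI[of _ "p + p'"]) simp
qed

lemma polynomial_fun_mult:
  assumes "polynomial_fun f" "polynomial_fun g"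
  shows "polynomial_fun (\<lambda>n. f n * g n)"
proof -
  obtain p p' where "\<forall>n. f n = poly p n" "\<forall>n. g n = poly p' n"
    using assms unfolding polynomial_fun_def by blast
  then show ?thesis
    unfolding polynomial_fun_def by (intro exI[of _ "p * p'"]) simp
qed

text \<open>Every quantity in the construction unfolds to sums and products of constants,
  \<open>n\<close> and \<open>poly p n\<close>, without subtraction.\<close>

lemma polynomial_fun_circuit_size: "polynomial_fun (\<lambda>n. circuit_size n (poly p n))"
  unfolding circuit_size_def Let_def violation_cost_def weight_scale_def
    rounding_error_def max_steps_def step_denominator_def
  by (intro polynomial_fun_add polynomial_fun_mult polynomial_fun_const polynomial_fun_ident
      polynomial_fun_poly)

theorem theorem7:
  shows "CF \<subseteq> P_poly"
proof
  fix L assume "L \<in> CF"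
  then obtain p :: "nat poly" where p: "\<forall>n. \<exists>A B b.
      conv (embed ` {x \<in> L. length x = n}) =
      {x. (\<forall>i\<ge>n. x i = 0) \<and>
          (\<exists>y. \<forall>j < poly p n.
              (\<Sum>i<n. A j i * x i) + (\<Sum>k<poly p n. B j k * y k) \<le> b j)}"
    unfolding CF_def by blast
  obtain r where r: "\<And>n. circuit_size n (poly p n) = poly r n"
    using polynomial_fun_circuit_size[of p] unfolding polynomial_fun_def by blast
  have "\<exists>C. circuit_wf n C \<and> length C \<le> poly r n \<and>
      (\<forall>x. length x = n \<longrightarrow> (circuit_out C x \<longleftrightarrow> x \<in> L))" for n
  proof (cases "{x \<in> L. length x = n} = {}")
    case True
    \<comment> \<open>An empty slice has no base vertex and no maximal slacks, so it gets a single
      constant gate; the size bound leaves room for it.\<close>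
    have "1 \<le> circuit_size n (poly p n)" by (simp add: circuit_size_def Let_def)
    with True show ?thesis
      by (intro exI[of _ "[Cst False]"])
        (auto simp: circuit_wf_def circuit_out_def gate_vals_def r)
  next
    case False
    obtain A B b where "conv (embed ` {x \<in> L. length x = n}) =
      {x. (\<forall>i\<ge>n. x i = 0) \<and>
          (\<exists>y. \<forall>j < poly p n.
              (\<Sum>i<n. A j i * x i) + (\<Sum>k<poly p n. B j k * y k) \<le> b j)}"
      using p by blast
    then interpret extended_formulation n "poly p n" "{x \<in> L. length x = n}" A B b
      by unfold_locales (use False in auto)
    show ?thesis using circuit_exists r by auto
  qed
  then show "L \<in> P_poly"
    unfolding P_poly_def by blast
qed

end
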